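(* For every integer $k\ge 0$, $|I_k(231,312)|=|I_k(12)|$.
   Context: A permutation of length $n$ is a word $\pi=\pi_1\cdots\pi_n$ containing each of $1,\dots,n$ exactly once. The sum of permutations $\rho=\rho_1\cdots\rho_n$ and $\tau=\tau_1\cdots\tau_m$ is the permutation $\rho\oplus\tau=\rho_1\cdots\rho_n(n+\tau_1)\cdots(n+\tau_m)$ of length $n+m$. A permutation is decomposable if it equals $\rho\oplus\tau$ for some non-empty permutations $\rho,\tau$; a non-empty permutation that is not decomposable is indecomposable. An inversion of $\pi$ is a pair $(i,j)$ with $i<j$ and $\pi_i>\pi_j$. A permutation $\pi$ contains a permutation (pattern) $\tau=\tau_1\cdots\tau_m$ if there are indices $i_1<\dots<i_m$ such that $\pi_{i_1},\dots,\pi_{i_m}$ is order-isomorphic to $\tau_1,\dots,\tau_m$; otherwise $\pi$ avoids $\tau$. $I_k(\tau_1,\dots,\tau_r)$ denotes the (finite) set of all indecomposable permutations, of any length, with exactly $k$ inversions that avoid all of $\tau_1,\dots,\tau_r$. *)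

theory Defs
  imports "HOL-Combinatorics.Multiset_Permutations"
begin

text \<open>
  A permutation of length \<open>n\<close> is the list of its values \<open>1, \<dots>, n\<close> in one-line notation.
  The values start at 1, but list positions start at 0. The empty list is the permutation of
  length 0.
\<close>

definition is_perm :: "nat list \<Rightarrow> bool" where
  "is_perm \<pi> \<longleftrightarrow> \<pi> \<in> permutations_of_set {1..length \<pi>}"

definition perm_sum :: "nat list \<Rightarrow> nat list \<Rightarrow> nat list" where
  "perm_sum \<rho> \<tau> = \<rho> @ map (\<lambda>x. length \<rho> + x) \<tau>"

definition decomposable :: "nat list \<Rightarrow> bool" where
  "decomposable \<pi> \<longleftrightarrow>
     (\<exists>\<rho> \<tau>. is_perm \<rho> \<and> is_perm \<tau> \<and> \<rho> \<noteq> [] \<and> \<tau> \<noteq> [] \<and> \<pi> = perm_sum \<rho> \<tau>)"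

definition indecomposable :: "nat list \<Rightarrow> bool" where
  "indecomposable \<pi> \<longleftrightarrow> is_perm \<pi> \<and> \<pi> \<noteq> [] \<and> \<not> decomposable \<pi>"

definition inversions :: "nat list \<Rightarrow> (nat \<times> nat) set" where
  "inversions \<pi> = {(i, j). i < j \<and> j < length \<pi> \<and> \<pi> ! i > \<pi> ! j}"

text \<open>The function \<open>f\<close> below lists the indices of the occurrence in increasing order.\<close>

definition contains_pattern :: "nat list \<Rightarrow> nat list \<Rightarrow> bool" where
  "contains_pattern \<pi> \<tau> \<longleftrightarrow>
     (\<exists>f :: nat \<Rightarrow> nat. strict_mono_on {..<length \<tau>} f \<and>
        (\<forall>a < length \<tau>. f a < length \<pi>) \<and>
        (\<forall>a < length \<tau>. \<forall>b < length \<tau>. \<pi> ! f a < \<pi> ! f b \<longleftrightarrow> \<tau> ! a < \<tau> ! b))"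

definition avoids :: "nat list \<Rightarrow> nat list \<Rightarrow> bool" where
  "avoids \<pi> \<tau> \<longleftrightarrow> \<not> contains_pattern \<pi> \<tau>"

definition indec_avoiders :: "nat \<Rightarrow> nat list set \<Rightarrow> nat list set" where
  "indec_avoiders k T =
     {\<pi>. indecomposable \<pi> \<and> card (inversions \<pi>) = k \<and> (\<forall>\<tau>\<in>T. avoids \<pi> \<tau>)}"

text \<open>
  The sets \<open>indec_avoiders k T\<close> are finite, so \<open>card\<close> is their true cardinality: every
  cut between adjacent positions of an indecomposable permutation is crossed by some inversion
  \<open>(i, j)\<close>, and for every \<open>l\<close> between \<open>i\<close> and \<open>j\<close> one of \<open>(i, l)\<close>, \<open>(l, j)\<close> is an inversion.
\<close>

lemma is_perm_iff: "is_perm \<pi> \<longleftrightarrow> distinct \<pi> \<and> set \<pi> = {1..length \<pi>}"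
  by (auto simp: is_perm_def permutations_of_set_def)

lemma finite_inversions: "finite (inversions \<pi>)"
  by (rule finite_subset[of _ "{..<length \<pi>} \<times> {..<length \<pi>}"]) (auto simp: inversions_def)

lemma cut_crossed_by_inversion:
  assumes ind: "indecomposable \<pi>" and p: "0 < p" "p < length \<pi>"
  shows "\<exists>(i, j) \<in> inversions \<pi>. i < p \<and> p \<le> j"
proof (rule ccontr)
  assume no: "\<not> ?thesis"
  define n where "n = length \<pi>"
  have perm: "distinct \<pi>" "set \<pi> = {1..n}"
    using ind by (auto simp: indecomposable_def is_perm_iff n_def)
  define A where "A = set (take p \<pi>)"
  define B where "B = set (drop p \<pi>)"
  have AB: "A \<union> B = {1..n}" "A \<inter> B = {}"
    using perm set_append[of "take p \<pi>" "drop p \<pi>"] distinct_append[of "take p \<pi>" "drop p \<pi>"]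
    by (simp_all add: A_def B_def)
  have lt: "x < y" if "x \<in> A" "y \<in> B" for x y
  proof -
    obtain i where i: "i < p" "x = \<pi> ! i"
      using \<open>x \<in> A\<close> by (auto simp: A_def in_set_conv_nth)
    obtain m where "m < n - p" "y = \<pi> ! (p + m)"
      using \<open>y \<in> B\<close> p by (auto simp: B_def in_set_conv_nth n_def)
    then obtain j where j: "p \<le> j" "j < n" "y = \<pi> ! j"
      by (metis le_add1 less_diff_conv add.commute)
    have "\<not> y < x"
    proof
      assume "y < x"
      then have "(i, j) \<in> inversions \<pi>"
        using i j by (simp add: inversions_def n_def)
      then show False using no i j by blast
    qed
    moreover have "x \<noteq> y"
      using that AB by auto
    ultimately show ?thesis by simp
  qed
  have cardA: "card A = p"
    unfolding A_def using perm p by (simp add: distinct_card)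
  have finA: "finite A" and finB: "finite B"
    by (auto simp: A_def B_def)
  have A_le: "x \<le> p" if "x \<in> A" for x
  proof -
    have "{1..x} \<subseteq> A"
    proof
      fix z assume z: "z \<in> {1..x}"
      have "x \<le> n" using that AB by auto
      then have "z \<in> A \<union> B" using z AB by auto
      moreover have "z \<notin> B" using lt[OF that, of z] z by auto
      ultimately show "z \<in> A" by blast
    qed
    from card_mono[OF finA this] show ?thesis by (simp add: cardA)
  qed
  have "A \<subseteq> {1..p}"
    using A_le AB by force
  then have A: "A = {1..p}"
    by (intro card_subset_eq) (auto simp: cardA)
  have B: "B = {p+1..n}"
  proof (intro equalityI subsetI)
    fix x assume "x \<in> B"
    then have "x \<in> {1..n}" "x \<notin> {1..p}" using AB A by blast+
    then show "x \<in> {p+1..n}" by auto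
  next
    fix x assume "x \<in> {p+1..n}"
    then have "x \<in> A \<union> B" "x \<notin> A" using AB A by auto
    then show "x \<in> B" by blast
  qed
  define \<tau> where "\<tau> = map (\<lambda>x. x - p) (drop p \<pi>)"
  have "is_perm (take p \<pi>)"
    using perm p A by (simp add: is_perm_iff A_def min_absorb2)
  moreover have "is_perm \<tau>"
  proof -
    have "inj_on (\<lambda>x. x - p) B"
      by (auto simp: inj_on_def B)
    then have "distinct \<tau>"
      using perm by (simp add: \<tau>_def distinct_map B_def)
    moreover have "(\<lambda>x. x - p) ` B = {1..n - p}"
    proof (intro equalityI subsetI)
      fix x assume "x \<in> {1..n - p}"
      then have "x + p \<in> B" "x = (x + p) - p" by (auto simp: B)
      then show "x \<in> (\<lambda>x. x - p) ` B" by blast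
    qed (auto simp: B)
    ultimately show ?thesis
      by (simp add: is_perm_iff \<tau>_def B_def n_def)
  qed
  moreover have "\<pi> = perm_sum (take p \<pi>) \<tau>"
  proof -
    have "map (\<lambda>x. p + (x - p)) (drop p \<pi>) = drop p \<pi>"
      using B by (intro map_idI) (auto simp: B_def)
    then show ?thesis
      using p by (simp add: perm_sum_def \<tau>_def comp_def min_absorb2)
  qed
  ultimately have "decomposable \<pi>"
    unfolding decomposable_def using p
    by (intro exI[of _ "take p \<pi>"] exI[of _ \<tau>]) (auto simp: \<tau>_def)
  then show False
    using ind by (simp add: indecomposable_def)
qed

lemma inversion_width_le:
  assumes "(i, j) \<in> inversions \<pi>"
  shows "card {i<..j} \<le> card (inversions \<pi>)"
proof (rule card_inj_on_le[where f = "\<lambda>l. if \<pi> ! i > \<pi> ! l then (i, l) else (l, j)"])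
  show "(\<lambda>l. if \<pi> ! i > \<pi> ! l then (i, l) else (l, j)) ` {i<..j} \<subseteq> inversions \<pi>"
    using assms by (auto simp: inversions_def le_less)
qed (auto simp: inj_on_def finite_inversions split: if_splits)

lemma indecomposable_length_le:
  assumes "indecomposable \<pi>"
  shows "length \<pi> \<le> card (inversions \<pi>) * card (inversions \<pi>) + 1"
proof -
  let ?I = "inversions \<pi>"
  have "{1..<length \<pi>} \<subseteq> (\<Union>(i, j)\<in>?I. {i<..j})"
  proof
    fix p assume "p \<in> {1..<length \<pi>}"
    then obtain i j where "(i, j) \<in> ?I" "i < p" "p \<le> j"
      using cut_crossed_by_inversion[OF assms, of p] by auto
    then show "p \<in> (\<Union>(i, j)\<in>?I. {i<..j})"
      by (intro UN_I[of "(i, j)"]) auto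
  qed
  then have "card {1..<length \<pi>} \<le> card (\<Union>(i, j)\<in>?I. {i<..j})"
    by (intro card_mono) (auto simp: finite_inversions)
  also have "\<dots> \<le> (\<Sum>x\<in>?I. card (case x of (i, j) \<Rightarrow> {i<..j}))"
    by (rule card_UN_le[OF finite_inversions])
  also have "\<dots> \<le> (\<Sum>x\<in>?I. card ?I)"
    by (rule sum_mono) (use inversion_width_le in \<open>auto split: prod.split\<close>)
  finally show ?thesis by simp
qed

lemma finite_indec_avoiders: "finite (indec_avoiders k T)"
proof (rule finite_subset)
  show "indec_avoiders k T \<subseteq> {\<pi>. set \<pi> \<subseteq> {1..k * k + 1} \<and> length \<pi> \<le> k * k + 1}"
  proof
    fix \<pi> assume "\<pi> \<in> indec_avoiders k T"
    then have ind: "indecomposable \<pi>" and k: "card (inversions \<pi>) = k"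
      by (simp_all add: indec_avoiders_def)
    have "set \<pi> = {1..length \<pi>}"
      using ind by (simp add: indecomposable_def is_perm_iff)
    moreover have "length \<pi> \<le> k * k + 1"
      using indecomposable_length_le[OF ind] by (simp only: k)
    ultimately show "\<pi> \<in> {\<pi>. set \<pi> \<subseteq> {1..k * k + 1} \<and> length \<pi> \<le> k * k + 1}"
      by simp
  qed
qed (rule finite_lists_length_le, simp)

end

theory Submission
  imports Defs
begin

text \<open>
  The two sets are equal, not merely equinumerous: an indecomposable permutation avoids both
  231 and 312 if and only if it is decreasing, that is, if and only if it avoids 12.

  Since 231 and 312 both contain 12, a permutation avoiding 12 avoids them. Conversely, let
  \<open>\<pi>\<close> be indecomposable and avoid 231 and 312, and suppose that it has an ascent
  \<open>b < c\<close> at adjacent positions. By indecomposability some inversion, with values \<open>a > d\<close>,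
  crosses the cut between \<open>b\<close> and \<open>c\<close>. If \<open>a < c\<close>, then \<open>a, c, d\<close> is an occurrence of 231; if
  \<open>c < a\<close>, then \<open>a, b, c\<close> is an occurrence of 312. So all adjacent pairs are
  descents (lemma \<open>indecomposable_adjacent_descent\<close>), and \<open>\<pi>\<close> is decreasing.
\<close>

lemma contains_12_iff:
  "contains_pattern \<pi> [1, 2] \<longleftrightarrow> (\<exists>i j. i < j \<and> j < length \<pi> \<and> \<pi> ! i < \<pi> ! j)"
proof
  assume "contains_pattern \<pi> [1, 2]"
  then obtain f :: "nat \<Rightarrow> nat" where f: "strict_mono_on {..<2} f" "f 1 < length \<pi>" "\<pi> ! f 0 < \<pi> ! f 1"
    by (auto simp: contains_pattern_def numeral_2_eq_2 less_Suc_eq all_conj_distrib)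
  then show "\<exists>i j. i < j \<and> j < length \<pi> \<and> \<pi> ! i < \<pi> ! j"
    by (intro exI[of _ "f 0"] exI[of _ "f 1"]) (auto simp: strict_mono_on_def)
next
  assume "\<exists>i j. i < j \<and> j < length \<pi> \<and> \<pi> ! i < \<pi> ! j"
  then obtain i j where "i < j" "j < length \<pi>" "\<pi> ! i < \<pi> ! j" by blast
  then show "contains_pattern \<pi> [1, 2]"
    unfolding contains_pattern_def
    by (intro exI[of _ "\<lambda>a. [i, j] ! a"]) (auto simp: strict_mono_on_def less_Suc_eq)
qed

lemma contains_pattern_of_three:
  assumes "i < j" "j < l" "l < length \<pi>"
    and "\<And>a b. a < 3 \<Longrightarrow> b < 3 \<Longrightarrow>
           \<pi> ! ([i, j, l] ! a) < \<pi> ! ([i, j, l] ! b) \<longleftrightarrow> [x, y, z] ! a < [x, y, z] ! b"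
  shows "contains_pattern \<pi> [x, y, z]"
  unfolding contains_pattern_def using assms
  by (intro exI[of _ "\<lambda>a. [i, j, l] ! a"])
    (auto simp: strict_mono_on_def less_Suc_eq numeral_3_eq_3)

lemma contains_231I:
  assumes "i < j" "j < l" "l < length \<pi>" "\<pi> ! l < \<pi> ! i" "\<pi> ! i < \<pi> ! j"
  shows "contains_pattern \<pi> [2, 3, 1]"
  by (rule contains_pattern_of_three[of i j l])
    (use assms in \<open>auto simp: less_Suc_eq numeral_3_eq_3\<close>)

lemma contains_312I:
  assumes "i < j" "j < l" "l < length \<pi>" "\<pi> ! j < \<pi> ! l" "\<pi> ! l < \<pi> ! i"
  shows "contains_pattern \<pi> [3, 1, 2]"
  by (rule contains_pattern_of_three[of i j l])
    (use assms in \<open>auto simp: less_Suc_eq numeral_3_eq_3\<close>)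

lemma contains_12_of_ascent:
  assumes "contains_pattern \<pi> \<tau>" "a < b" "b < length \<tau>" "\<tau> ! a < \<tau> ! b"
  shows "contains_pattern \<pi> [1, 2]"
proof -
  obtain f where "strict_mono_on {..<length \<tau>} f" "\<forall>a < length \<tau>. f a < length \<pi>"
    "\<forall>a < length \<tau>. \<forall>b < length \<tau>. \<pi> ! f a < \<pi> ! f b \<longleftrightarrow> \<tau> ! a < \<tau> ! b"
    using assms(1) unfolding contains_pattern_def by blast
  then show ?thesis
    unfolding contains_12_iff using assms
    by (intro exI[of _ "f a"] exI[of _ "f b"]) (auto simp: strict_mono_on_def)
qed

lemma indecomposable_adjacent_descent:
  assumes ind: "indecomposable \<pi>" and av: "avoids \<pi> [2, 3, 1]" "avoids \<pi> [3, 1, 2]"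
    and p: "Suc p < length \<pi>"
  shows "\<pi> ! Suc p < \<pi> ! p"
proof (rule ccontr)
  have inj: "\<pi> ! i = \<pi> ! j \<longleftrightarrow> i = j" if "i < length \<pi>" "j < length \<pi>" for i j
    using ind that by (simp add: indecomposable_def is_perm_iff nth_eq_iff_index_eq)
  assume "\<not> \<pi> ! Suc p < \<pi> ! p"
  then have asc: "\<pi> ! p < \<pi> ! Suc p"
    using inj[of p "Suc p"] p by simp
  obtain i j where ij: "i \<le> p" "Suc p \<le> j" "j < length \<pi>" "\<pi> ! j < \<pi> ! i"
    using cut_crossed_by_inversion[OF ind, of "Suc p"] p by (auto simp: inversions_def less_Suc_eq_le)
  have "\<pi> ! i \<noteq> \<pi> ! Suc p"
    using inj[of i "Suc p"] ij p by simp
  then consider "\<pi> ! i < \<pi> ! Suc p" | "\<pi> ! Suc p < \<pi> ! i" by linarith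
  then show False
  proof cases
    case 1
    then have "Suc p \<noteq> j" using ij by auto
    then have "contains_pattern \<pi> [2, 3, 1]"
      using ij 1 by (intro contains_231I[of i "Suc p" j]) auto
    then show False using av by (simp add: avoids_def)
  next
    case 2
    then have "i \<noteq> p" using asc by auto
    then have "contains_pattern \<pi> [3, 1, 2]"
      using ij asc 2 p by (intro contains_312I[of i p "Suc p"]) auto
    then show False using av by (simp add: avoids_def)
  qed
qed

lemma indecomposable_avoids_231_312_iff:
  assumes ind: "indecomposable \<pi>"
  shows "avoids \<pi> [2, 3, 1] \<and> avoids \<pi> [3, 1, 2] \<longleftrightarrow> avoids \<pi> [1, 2]"
proof
  assume av: "avoids \<pi> [2, 3, 1] \<and> avoids \<pi> [3, 1, 2]"
  have "sorted_wrt (\<lambda>x y. y < x) \<pi>"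
    using indecomposable_adjacent_descent[OF ind] av
    by (subst sorted_wrt_iff_nth_Suc_transp) (auto simp: transp_def)
  then show "avoids \<pi> [1, 2]"
    unfolding avoids_def contains_12_iff
    by (meson sorted_wrt_iff_nth_less less_asym)
next
  assume "avoids \<pi> [1, 2]"
  then show "avoids \<pi> [2, 3, 1] \<and> avoids \<pi> [3, 1, 2]"
    using contains_12_of_ascent[of \<pi> "[2, 3, 1]" 0 1] contains_12_of_ascent[of \<pi> "[3, 1, 2]" 1 2]
    by (auto simp: avoids_def)
qed

theorem theorem11:
  fixes k :: nat
  shows "card (indec_avoiders k {[2, 3, 1], [3, 1, 2]}) = card (indec_avoiders k {[1, 2]})"
proof -
  have "indec_avoiders k {[2, 3, 1], [3, 1, 2]} = indec_avoiders k {[1, 2]}"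
    unfolding indec_avoiders_def
    using indecomposable_avoids_231_312_iff by auto
  then show ?thesis by simp
qed

end
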